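(* Let $G$ be an infinite countable group such that $\mathbb{Z}$ is a homomorphic image of $G$. For every integer $m\geq 1$, there exists a minimal subshift $X\subseteq \{0,\dots,m-1\}^G$ whose topological sequence entropy $h^*_{top}(X,\sigma,G)$ equals $\log(m)$.
   Context: For a finite set $\Sigma$ with the discrete topology, $\Sigma^G$ carries the product topology and the left shift action $\sigma$ of $G$ given by $\sigma^g(x)(h)=x(g^{-1}h)$ for $g,h\in G$, $x\in\Sigma^G$. A subshift is a nonempty closed $\sigma$-invariant subset $X\subseteq \Sigma^G$. A dynamical system $(X,\varphi,G)$ (continuous action of $G$ on a compact metric space $X$) is minimal if every orbit $\{\varphi^g x:g\in G\}$ is dense. For an open cover $\mathcal U$ of $X$ and a sequence $S=(g_n)_{n\in\mathbb N}$ in $G$, set $h^*_{top}(X,\varphi,G,\mathcal U;S)=\limsup_{n\to\infty}\frac1n\log N\big(\bigvee_{i=1}^n\varphi^{g_i^{-1}}\mathcal U\big)$, where $N(\mathcal C)$ is the minimal cardinality of a subcover of $\mathcal C$; the topological sequence entropy is $h^*_{top}(X,\varphi,G)=\sup_{\mathcal U,S}h^*_{top}(X,\varphi,G,\mathcal U;S)$, the supremum over all open covers and all sequences in $G$. *)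

theory Defs
  imports "HOL-Analysis.Analysis"
begin

definition full_shift_top :: "nat \<Rightarrow> ('g \<Rightarrow> nat) topology" where
  "full_shift_top m = product_topology (\<lambda>_. discrete_topology {..<m}) UNIV"

text \<open>Left shift: (shift g x)(h) = x(g^{-1} h); the group G is written additively.\<close>
definition shift :: "'g::group_add \<Rightarrow> ('g \<Rightarrow> 'a) \<Rightarrow> ('g \<Rightarrow> 'a)" where
  "shift g x = (\<lambda>h. x (- g + h))"

definition is_subshift :: "nat \<Rightarrow> ('g::group_add \<Rightarrow> nat) set \<Rightarrow> bool" where
  "is_subshift m X \<longleftrightarrow> X \<noteq> {} \<and> X \<subseteq> topspace (full_shift_top m)
     \<and> closedin (full_shift_top m) X \<and> (\<forall>g. shift g ` X \<subseteq> X)"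

definition minimal_system :: "'x topology \<Rightarrow> ('g \<Rightarrow> 'x \<Rightarrow> 'x) \<Rightarrow> bool" where
  "minimal_system T \<phi> \<longleftrightarrow>
     (\<forall>x\<in>topspace T. T closure_of (range (\<lambda>g. \<phi> g x)) = topspace T)"

definition open_cover :: "'x topology \<Rightarrow> 'x set set \<Rightarrow> bool" where
  "open_cover T U \<longleftrightarrow> (\<forall>A\<in>U. openin T A) \<and> \<Union>U = topspace T"

definition min_subcover_card :: "'x topology \<Rightarrow> 'x set set \<Rightarrow> nat" where
  "min_subcover_card T C = Inf {card V | V. V \<subseteq> C \<and> finite V \<and> \<Union>V = topspace T}"

definition cover_join :: "'x topology \<Rightarrow> (nat \<Rightarrow> 'x set set) \<Rightarrow> nat \<Rightarrow> 'x set set" where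
  "cover_join T C n = {topspace T \<inter> (\<Inter>i\<in>{1..n}. A i) | A. \<forall>i\<in>{1..n}. A i \<in> C i}"

definition seq_entropy_cover ::
  "'x topology \<Rightarrow> ('g::group_add \<Rightarrow> 'x \<Rightarrow> 'x) \<Rightarrow> 'x set set \<Rightarrow> (nat \<Rightarrow> 'g) \<Rightarrow> ereal" where
  "seq_entropy_cover T \<phi> U S =
     limsup (\<lambda>n. ereal (ln (real (min_subcover_card T
        (cover_join T (\<lambda>i. (\<lambda>A. \<phi> (- S i) ` A) ` U) n))) / real n))"

definition top_seq_entropy :: "'x topology \<Rightarrow> ('g::group_add \<Rightarrow> 'x \<Rightarrow> 'x) \<Rightarrow> ereal" where
  "top_seq_entropy T \<phi> = (SUP US \<in> {(U, S). open_cover T U}. seq_entropy_cover T \<phi> (fst US) (snd US))"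

end

theory Submission
  imports Defs
begin

text \<open>In base B = 2m + 1 give the digit 2k + 1 the weight k and every even digit the weight 0.
  The weighted digit sum t(n) makes sense for negative n as well, the leading digits 2m being
  weightless. The subshift consists of the limits of translates of t mod m, pulled back along the
  homomorphism onto the integers.

  Minimality: any finite pattern of t recurs with bounded gaps, because shifting by q B^K with
  t(q) = t(q - 1) = 0 mod m does not change it. Lower bound: the positions N + B^i are independent,
  since adding 1 to N = B N' + 2k changes t by an arbitrary prescribed k.
  Upper bound: the increment t(e) - t(e - 1) depends only on the last nonzero digit of e, so on a
  finite set F the increment sequence has only O(|F|^2) patterns among its translates. Hence
  t mod m has at most m^n O(n^2) patterns on n translates of a fixed window:
  a pattern is determined by one value per window and by the increments.\<close>

section \<open>Weighted digit sums\<close>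

abbreviation radix :: "nat \<Rightarrow> int" where
  "radix m \<equiv> 2 * int m + 1"

lemma mod_radix_bounds: "0 \<le> r mod radix m" "r mod radix m < radix m"
  by (rule pos_mod_sign pos_mod_bound; simp)+

definition weight :: "int \<Rightarrow> nat" where
  "weight r = (if odd r then nat (r div 2) else 0)"

text \<open>Floor division by the radix shrinks absolute values except at its fixed points 0 and -1,
  which are therefore base cases. The guard \<open>m = 0\<close> excludes radix 1, where division
  changes nothing.\<close>

function digit_sum :: "nat \<Rightarrow> int \<Rightarrow> nat" where
  "digit_sum m n = (if m = 0 \<or> n = 0 \<or> n = -1 then 0
     else weight (n mod radix m) + digit_sum m (n div radix m))"
  by auto

text \<open>Supplies the termination measure of \<open>digit_sum\<close>. For
  \<open>n \<le> -2\<close> the floor quotient stays negative but moves strictly towards 0.\<close>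

lemma abs_div_less:
  fixes n b :: int
  assumes "b \<ge> 2" "n \<noteq> 0" "n \<noteq> -1"
  shows "\<bar>n div b\<bar> < \<bar>n\<bar>"
proof (cases "n > 0")
  case True
  then have "n div b < n" using assms by (intro int_div_less_self) auto
  moreover have "n div b \<ge> 0" using True assms by (simp add: pos_imp_zdiv_nonneg_iff)
  ultimately show ?thesis by simp
next
  case False
  then have n: "n \<le> -2" using assms by auto
  have "n div b < 0" using n assms by (intro div_neg_pos_less0) auto
  moreover have "n < n div b"
  proof (rule ccontr)
    assume "\<not> ?thesis"
    then have "b * (n div b) \<le> b * n" using assms by simp
    moreover have "n = b * (n div b) + n mod b" by simp
    moreover have "n mod b < b" using assms by simp
    ultimately have "n < b * n + b" by linarith
    moreover have "(b - 1) * n \<le> (b - 1) * (-2)" using n assms by (intro mult_left_mono) auto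
    then have "b * n + 2 * b \<le> n + 2" by (simp add: algebra_simps)
    ultimately show False using assms by linarith
  qed
  ultimately show ?thesis by linarith
qed

termination digit_sum
proof (relation "Wellfounded.measure (\<lambda>(m, n). nat \<bar>n\<bar>)", goal_cases)
  case (2 m n)
  then have "\<bar>n div radix m\<bar> < \<bar>n\<bar>" by (intro abs_div_less) auto
  then show ?case by auto
qed auto

declare digit_sum.simps [simp del]

lemma digit_sum_0 [simp]: "digit_sum m 0 = 0" and digit_sum_minus_1 [simp]: "digit_sum m (-1) = 0"
  by (subst digit_sum.simps; simp)+

lemma weight_even [simp]: "weight (2 * k) = 0" and weight_odd [simp]: "weight (2 * k + 1) = nat k"
  by (auto simp: weight_def)

text \<open>The extreme digits 0 and 2m have weight 0, so the digit recursion also holds at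
  0 and -1, the fixed points of division by the radix.\<close>
lemma digit_sum_digit:
  assumes "m \<ge> 1" "0 \<le> r" "r < radix m"
  shows "digit_sum m (radix m * q + r) = digit_sum m q + weight r"
proof -
  let ?n = "radix m * q + r"
  have dm: "?n mod radix m = r" "?n div radix m = q"
    using assms by (auto simp: mod_pos_pos_trivial div_pos_pos_trivial simp del: One_nat_def)
  show ?thesis
  proof (cases "?n = 0 \<or> ?n = -1")
    case False
    then show ?thesis using dm assms by (subst digit_sum.simps) auto
  next
    case True
    then consider "?n = 0" | "?n = -1" by blast
    then show ?thesis
    proof cases
      case 1
      then have "r = 0" "q = 0" using dm by auto
      then show ?thesis by (simp add: weight_def)
    next
      case 2
      have "q = -1" using dm(2) 2 assms
        by (metis div_eq_minus1 dual_order.strict_trans1 zero_less_one of_nat_0_le_iff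
            zle_add1_eq_le zero_le_mult_iff zero_le_numeral)
      moreover have "r = 2 * int m" using 2 calculation by simp
      ultimately show ?thesis using 2 by simp
    qed
  qed
qed

text \<open>Writing \<open>r\<close> below \<open>q\<close> causes no carry, and padding
  \<open>r\<close> to \<open>k\<close> digits adds only weightless zeros. The induction peels off
  the last digit of \<open>r\<close>.\<close>

lemma digit_sum_block:
  assumes "m \<ge> 1" "0 \<le> r" "r < radix m ^ k"
  shows "digit_sum m (radix m ^ k * q + r) = digit_sum m q + digit_sum m r"
  using assms(2,3)
proof (induction k arbitrary: r)
  case 0
  then have "r = 0" by simp
  then show ?case by simp
next
  case (Suc k)
  let ?B = "radix m"
  define u v where "u = r div ?B" and "v = r mod ?B"
  have r: "r = ?B * u + v" and v: "0 \<le> v" "v < ?B"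
    using mod_radix_bounds[of r m] by (simp_all add: u_def v_def)
  have u: "0 \<le> u" using Suc.prems by (simp add: u_def pos_imp_zdiv_nonneg_iff)
  have "r < ?B * ?B ^ k" using Suc.prems by (simp only: power_Suc)
  then have "?B * u < ?B * ?B ^ k" using r v(1) by linarith
  then have u': "u < ?B ^ k" by (subst (asm) mult_less_cancel_left_pos) auto
  have "?B ^ Suc k * q + r = ?B * (?B ^ k * q + u) + v" by (simp add: r algebra_simps)
  then have "digit_sum m (?B ^ Suc k * q + r) = digit_sum m (?B ^ k * q + u) + weight v"
    using digit_sum_digit[OF assms(1) v] by metis
  also have "\<dots> = digit_sum m q + digit_sum m r"
    using digit_sum_digit[OF assms(1) v, of u] Suc.IH[OF u u'] r by (metis add.assoc)
  finally show ?case .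
qed

section \<open>Recurrence and independence of the digit sum modulo \<open>m\<close>\<close>

definition dseq :: "nat \<Rightarrow> int \<Rightarrow> nat" where
  "dseq m n = digit_sum m n mod m"

lemma dseq_less: "m \<ge> 1 \<Longrightarrow> dseq m n < m"
  by (simp add: dseq_def)

text \<open>Adding \<open>radix m ^ k * q\<close> to \<open>j\<close> puts \<open>q\<close> in front
  of the digits of \<open>j\<close> if \<open>j \<ge> 0\<close>, and \<open>q - 1\<close> if a
  borrow occurs. It is therefore enough that both \<open>q\<close> and \<open>q - 1\<close> have
  digit sum 0 modulo \<open>m\<close>. One \<open>q\<close> serves all \<open>k\<close>, and it is
  found by appending two digits to \<open>p\<close>.\<close>

lemma dseq_recurrent_block:
  assumes m: "m \<ge> 1"
  obtains q where "radix m ^ 2 * p \<le> q" "q < radix m ^ 2 * (p + 1)"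
    "\<And>k j. - (radix m ^ k) \<le> j \<Longrightarrow> j < radix m ^ k \<Longrightarrow> dseq m (radix m ^ k * q + j) = dseq m j"
proof -
  let ?B = "radix m"
  \<comment> \<open>The appended digit \<open>2 * c + 1\<close> has weight \<open>c\<close>, chosen
    to cancel the digit sum of \<open>p\<close> modulo \<open>m\<close>.\<close>
  define c where "c = (m - digit_sum m p mod m) mod m"
  have c: "c < m" "(digit_sum m p + c) mod m = 0"
  proof -
    show "c < m" using m by (simp add: c_def)
    have "(digit_sum m p + c) mod m = (digit_sum m p mod m + (m - digit_sum m p mod m)) mod m"
      unfolding c_def by (metis mod_add_eq mod_mod_trivial)
    also have "\<dots> = m mod m" using m by simp
    finally show "(digit_sum m p + c) mod m = 0" by simp
  qed
  \<comment> \<open>The last digit 1 becomes 0 in \<open>q - 1\<close>. Both are weightless and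
    nothing is borrowed, so the two digit sums agree.\<close>
  define q where "q = ?B * (?B * p + (2 * int c + 1)) + 1"
  have q0: "digit_sum m q = digit_sum m p + c"
  proof -
    have "digit_sum m q = digit_sum m (?B * p + (2 * int c + 1)) + weight 1"
      unfolding q_def using m by (intro digit_sum_digit) auto
    also have "digit_sum m (?B * p + (2 * int c + 1)) = digit_sum m p + weight (2 * int c + 1)"
      using m c by (intro digit_sum_digit) auto
    finally show ?thesis by (simp add: weight_def)
  qed
  have q1: "digit_sum m (q - 1) = digit_sum m p + c"
  proof -
    have "digit_sum m (q - 1) = digit_sum m (?B * (?B * p + (2 * int c + 1)) + 0)"
      by (simp add: q_def)
    also have "\<dots> = digit_sum m (?B * p + (2 * int c + 1)) + weight 0"
      using m by (intro digit_sum_digit) auto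
    also have "digit_sum m (?B * p + (2 * int c + 1)) = digit_sum m p + weight (2 * int c + 1)"
      using m c by (intro digit_sum_digit) auto
    finally show ?thesis by (simp add: weight_def)
  qed
  show ?thesis
  proof (rule that[of q])
    show "?B ^ 2 * p \<le> q" by (simp add: q_def power2_eq_square algebra_simps)
    have "?B * (2 * int c + 1) + 1 \<le> ?B * (2 * int m - 1) + 1"
      using c by (intro add_right_mono mult_left_mono) auto
    also have "\<dots> < ?B ^ 2" using m by (simp add: power2_eq_square algebra_simps)
    finally show "q < ?B ^ 2 * (p + 1)"
      by (simp add: q_def power2_eq_square algebra_simps)
    fix k j assume j: "- (?B ^ k) \<le> j" "j < ?B ^ k"
    show "dseq m (?B ^ k * q + j) = dseq m j"
    proof (cases "j \<ge> 0")
      case True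
      then have "digit_sum m (?B ^ k * q + j) = digit_sum m p + c + digit_sum m j"
        using digit_sum_block[OF m True j(2)] q0 by simp
      then show ?thesis using c(2) unfolding dseq_def by (metis add_0 mod_add_left_eq)
    next
      case False
      have r: "0 \<le> j + ?B ^ k" "j + ?B ^ k < ?B ^ k" using j False by auto
      \<comment> \<open>The same borrow turns \<open>j\<close> into the block
        \<open>j + ?B ^ k\<close> with leading part -1, whose digit sum is 0.\<close>
      have "?B ^ k * q + j = ?B ^ k * (q - 1) + (j + ?B ^ k)" by (simp add: algebra_simps)
      then have "digit_sum m (?B ^ k * q + j) = digit_sum m p + c + digit_sum m (j + ?B ^ k)"
        using digit_sum_block[OF m r, of "q - 1"] q1 by metis
      moreover have "digit_sum m j = digit_sum m (j + ?B ^ k)"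
        using digit_sum_block[OF m r, of "-1"] by simp
      ultimately show ?thesis using c(2) unfolding dseq_def by (metis add_0 mod_add_left_eq)
    qed
  qed
qed

text \<open>Once \<open>radix m ^ K\<close> exceeds every \<open>\<bar>N' + e\<bar>\<close>,
  translating by \<open>radix m ^ K * q\<close> with \<open>q\<close> from
  \<open>dseq_recurrent_block\<close> preserves the pattern. Every block of length
  \<open>radix m ^ (K + 2)\<close> contains such a translation, so \<open>L\<close> depends on the
  pattern but not on \<open>N\<close>.\<close>

lemma dseq_uniformly_recurrent:
  assumes m: "m \<ge> 1" and E: "finite E"
  obtains L :: nat where
    "\<And>N. \<exists>k<L. \<forall>e\<in>E. dseq m (N + int k + e) = dseq m (N' + e)"
proof -
  let ?B = "radix m"
  obtain K :: nat where K: "\<forall>e\<in>E. \<bar>N' + e\<bar> < ?B ^ K"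
  proof -
    have "finite ((\<lambda>e. nat \<bar>N' + e\<bar>) ` E)" using E by simp
    then obtain K where K: "\<forall>x\<in>(\<lambda>e. nat \<bar>N' + e\<bar>) ` E. x \<le> K"
      by (auto simp: finite_nat_set_iff_bounded_le)
    have "int K < ?B ^ K"
    proof -
      have "int K < 2 ^ K" using of_nat_less_two_power[of K] by auto
      also have "(2::int) ^ K \<le> ?B ^ K" using m by (intro power_mono) auto
      finally show ?thesis .
    qed
    then show ?thesis using K by (intro that[of K]) fastforce
  qed
  let ?M = "?B ^ (K + 2)"
  have M: "?M > 0" by simp
  show ?thesis
  proof (rule that[of "nat (2 * ?M + 1)"])
    fix N
    \<comment> \<open>The \<open>+ 1\<close> selects the first block starting beyond
      \<open>N - N'\<close>. This makes \<open>k\<close> nonnegative and keeps it within two block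
      lengths.\<close>
    define p where "p = (N - N') div ?M + 1"
    obtain q where q: "?B ^ 2 * p \<le> q" "q < ?B ^ 2 * (p + 1)"
      and qd: "\<And>k j. - (?B ^ k) \<le> j \<Longrightarrow> j < ?B ^ k \<Longrightarrow> dseq m (?B ^ k * q + j) = dseq m j"
      using dseq_recurrent_block[OF m, of p] by metis
    have Mp: "?M * p = N - N' - (N - N') mod ?M + ?M"
      unfolding p_def using mult_div_mod_eq[of ?M "N - N'"] by (simp add: algebra_simps)
    have md: "0 \<le> (N - N') mod ?M" "(N - N') mod ?M < ?M" using M by auto
    have "?B ^ K * (?B ^ 2 * p) \<le> ?B ^ K * q" using q by (intro mult_left_mono) auto
    then have a: "?M * p \<le> ?B ^ K * q" by (simp only: power_add mult.assoc)
    have "?B ^ K * q < ?B ^ K * (?B ^ 2 * (p + 1))" using q by (intro mult_strict_left_mono) auto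
    also have "\<dots> = ?M * p + ?M" by (simp only: power_add distrib_left mult.assoc mult_1_right)
    finally have b: "?B ^ K * q < ?M * p + ?M" .
    define k where "k = ?B ^ K * q + N' - N"
    have k: "0 \<le> k" "k < 2 * ?M + 1" unfolding k_def using a b Mp md by linarith+
    show "\<exists>k<nat (2 * ?M + 1). \<forall>e\<in>E. dseq m (N + int k + e) = dseq m (N' + e)"
    proof (intro exI[of _ "nat k"] conjI ballI)
      show "nat k < nat (2 * ?M + 1)" using k by simp
      fix e assume "e \<in> E"
      then have "- (?B ^ K) \<le> N' + e" "N' + e < ?B ^ K" using K by force+
      from qd[OF this] show "dseq m (N + int (nat k) + e) = dseq m (N' + e)"
        using k by (simp add: k_def algebra_simps)
    qed
  qed
qed

text \<open>The value at \<open>N\<close> itself is prescribed as well, to carry the induction: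
  after appending a last digit \<open>2 * k\<close>, adding \<open>radix m ^ Suc i\<close> acts on
  the old \<open>N\<close> as adding \<open>radix m ^ i\<close>, while adding 1 raises the old digit
  sum by \<open>k\<close>.\<close>

lemma dseq_independent:
  assumes m: "m \<ge> 1"
  shows "\<exists>N. dseq m N = b mod m \<and> (\<forall>i<n. dseq m (N + radix m ^ i) = a i mod m)"
proof (induction n arbitrary: a)
  case 0
  have "digit_sum m (radix m * 0 + (2 * int (b mod m) + 1)) = digit_sum m 0 + weight (2 * int (b mod m) + 1)"
  proof (rule digit_sum_digit[OF m])
    have "b mod m < m" using m by simp
    then show "2 * int (b mod m) + 1 < radix m" by linarith
  qed simp
  then have "dseq m (2 * int (b mod m) + 1) = b mod m" by (simp add: dseq_def)
  then show ?case by blast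
next
  case (Suc n)
  let ?B = "radix m"
  obtain N where N: "dseq m N = b mod m" "\<forall>i<n. dseq m (N + ?B ^ i) = a (Suc i) mod m"
    using Suc.IH[of "\<lambda>i. a (Suc i)"] by blast
  \<comment> \<open>This is \<open>a 0 - b\<close> modulo \<open>m\<close>, arranged to avoid
    truncated subtraction.\<close>
  define k where "k = (a 0 + (m - b mod m)) mod m"
  have k: "k < m" using m by (simp add: k_def)
  have e: "digit_sum m (?B * x + 2 * int k) = digit_sum m x" for x
    using digit_sum_digit[OF m, of "2 * int k" x] k by simp
  have o: "digit_sum m (?B * x + (2 * int k + 1)) = digit_sum m x + k" for x
    using digit_sum_digit[OF m, of "2 * int k + 1" x] k by simp
  show ?case
  proof (intro exI[of _ "?B * N + 2 * int k"] conjI allI impI)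
    show "dseq m (?B * N + 2 * int k) = b mod m" using N e by (simp add: dseq_def)
    fix i assume i: "i < Suc n"
    show "dseq m (?B * N + 2 * int k + ?B ^ i) = a i mod m"
    proof (cases i)
      case 0
      have "dseq m (?B * N + 2 * int k + ?B ^ i) = (digit_sum m N + k) mod m"
        using o[of N] 0 by (simp add: dseq_def add.assoc)
      also have "\<dots> = (b mod m + (a 0 + (m - b mod m))) mod m"
        using N(1) unfolding k_def dseq_def by (metis mod_add_eq mod_mod_trivial)
      also have "b mod m + (a 0 + (m - b mod m)) = a 0 + m"
        using mod_less_divisor[of m b] m by linarith
      finally show ?thesis using 0 by simp
    next
      case (Suc i')
      have "?B * N + 2 * int k + ?B ^ i = ?B * (N + ?B ^ i') + 2 * int k"
        by (simp add: Suc algebra_simps)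
      then have "dseq m (?B * N + 2 * int k + ?B ^ i) = dseq m (N + ?B ^ i')"
        unfolding dseq_def by (metis e)
      then show ?thesis using N(2) Suc i by simp
    qed
  qed
qed

section \<open>Patterns of the increments\<close>

definition jump :: "nat \<Rightarrow> int \<Rightarrow> int" where
  "jump m e = int (digit_sum m e) - int (digit_sum m (e - 1))"

text \<open>A trailing digit 0 is weightless, and so is the digit \<open>2 * m\<close> that replaces
  it after a borrow.\<close>

lemma jump_mult_radix:
  assumes m: "m \<ge> 1"
  shows "jump m (radix m * e) = jump m e"
proof -
  have "radix m * e - 1 = radix m * (e - 1) + 2 * int m" by (simp add: algebra_simps)
  then have "digit_sum m (radix m * e - 1) = digit_sum m (e - 1)"
    using digit_sum_digit[OF m, of "2 * int m" "e - 1"] by simp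
  moreover have "digit_sum m (radix m * e) = digit_sum m e"
    using digit_sum_digit[OF m, of 0 e] by (simp add: weight_def)
  ultimately show ?thesis by (simp add: jump_def)
qed

lemma jump_mult_power: "m \<ge> 1 \<Longrightarrow> jump m (radix m ^ k * e) = jump m e"
  by (induction k) (simp_all add: jump_mult_radix mult.assoc)

text \<open>A nonzero last digit absorbs the subtraction of 1 without a borrow, so the contributions
  of the higher digits cancel.\<close>

lemma jump_not_dvd:
  assumes m: "m \<ge> 1" and e: "\<not> radix m dvd e"
  shows "jump m e = int (weight (e mod radix m)) - int (weight (e mod radix m - 1))"
proof -
  let ?r = "e mod radix m"
  have "?r \<noteq> 0" using e by (simp add: dvd_eq_mod_eq_0)
  moreover have "0 \<le> ?r" "?r < radix m" using mod_radix_bounds[of e m] by blast+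
  ultimately have r: "0 \<le> ?r" "?r < radix m" "0 \<le> ?r - 1" "?r - 1 < radix m" by linarith+
  have "radix m * (e div radix m) + ?r = e" by simp
  then have "digit_sum m e = digit_sum m (e div radix m) + weight ?r"
    "digit_sum m (e - 1) = digit_sum m (e div radix m) + weight (?r - 1)"
    using digit_sum_digit[OF m r(1,2), of "e div radix m"] digit_sum_digit[OF m r(3,4), of "e div radix m"]
    by (simp_all add: algebra_simps)
  then show ?thesis by (simp add: jump_def)
qed

text \<open>The last nonzero digit determines the jump, and it is visible modulo
  \<open>radix m ^ k\<close> as soon as that power does not divide \<open>e\<close>.\<close>

lemma jump_cong:
  assumes m: "m \<ge> 1"
  shows "\<not> radix m ^ k dvd e \<Longrightarrow> radix m ^ k dvd e' - e \<Longrightarrow> jump m e' = jump m e"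
proof (induction k arbitrary: e e')
  case 0
  then show ?case by simp
next
  case (Suc k)
  let ?B = "radix m"
  have B: "?B dvd e' - e" using Suc.prems(2) by (metis dvd_mult_left power_Suc)
  show ?case
  proof (cases "?B dvd e")
    case True
    moreover have "?B dvd e'" using dvd_add[OF B True] by simp
    ultimately obtain u u' where u: "e = ?B * u" "e' = ?B * u'" by (auto simp: dvd_def)
    have "\<not> ?B ^ k dvd u" using Suc.prems(1) u(1) by simp
    moreover have "?B * ?B ^ k dvd ?B * (u' - u)" using Suc.prems(2) u by (simp add: right_diff_distrib)
    then have "?B ^ k dvd u' - u" by (subst (asm) dvd_mult_cancel_left) auto
    ultimately show ?thesis using Suc.IH[of u u'] u jump_mult_radix[OF m] by simp
  next
    case False
    moreover have "\<not> ?B dvd e'" using dvd_diff[of ?B e' "e' - e"] B False by auto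
    moreover have "e' mod ?B = e mod ?B" using B by (simp add: mod_eq_dvd_iff)
    ultimately show ?thesis using jump_not_dvd[OF m] by simp
  qed
qed

lemma exists_power_not_dvd:
  fixes F :: "int set"
  assumes "finite F" "0 \<notin> F" "b \<ge> 2"
  obtains k where "\<forall>x\<in>F. \<not> b ^ k dvd x"
proof -
  obtain K where K: "\<forall>x\<in>(\<lambda>x. nat \<bar>x\<bar>) ` F. x \<le> K"
    using assms(1) finite_nat_set_iff_bounded_le[of "(\<lambda>x. nat \<bar>x\<bar>) ` F"] by auto
  have "int K < 2 ^ K" using of_nat_less_two_power[of K] by auto
  also have "(2::int) ^ K \<le> b ^ K" using assms by (intro power_mono) auto
  finally have "int K < b ^ K" .
  then have K': "\<bar>x\<bar> < b ^ K" if "x \<in> F" for x using K that by fastforce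
  have "\<forall>x\<in>F. \<not> b ^ K dvd x"
  proof
    fix x assume x: "x \<in> F"
    then have "x \<noteq> 0" using assms(2) by blast
    then show "\<not> b ^ K dvd x" using K'[OF x] dvd_imp_le_int[of x "b ^ K"] by linarith
  qed
  then show ?thesis by (rule that)
qed

text \<open>If l is the largest valuation occurring in N + F, attained at f, then N may be replaced
  by -f + c B^l with c a nonzero digit. Moreover l matters only through the two sets
  of f' in F with B^l, respectively B^(l+1), dividing f' - f, so l may be taken
  from a list of valuations of differences.\<close>
lemma jump_patterns:
  assumes m: "m \<ge> 1" and F: "finite F" "F \<noteq> {}"
  obtains R where "finite R" "card R \<le> 3 * (2 * m + 1) * card F ^ 2"
    "\<And>N. \<exists>N'\<in>R. \<forall>f\<in>F. jump m (N + f) = jump m (N' + f)"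
proof -
  let ?B = "radix m"
  \<comment> \<open>For \<open>f' \<noteq> f\<close> this is one more than the valuation of
    \<open>f' - f\<close>.\<close>
  define \<kappa> where "\<kappa> f' f = (LEAST k. \<not> ?B ^ k dvd f' - f)" for f' f
  define I where "I = F \<times> F \<times> {..<2 * m + 1} \<times> {..<3::nat}"
  \<comment> \<open>The tag \<open>b\<close> selects the exponent: 0 for \<open>b = 0\<close>,
    \<open>\<kappa> f' f\<close> for \<open>b = 1\<close>, and one less, the valuation itself, for
    \<open>b = 2\<close>.\<close>
  define h where "h = (\<lambda>(f, f', c, b). - f + int c * ?B ^ (if b = 0 then 0 else \<kappa> f' f - (b - 1)))"
  have \<kappa>: "\<kappa> f' f = Suc k" if "?B ^ k dvd f' - f" "\<not> ?B ^ Suc k dvd f' - f" for f' f k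
    unfolding \<kappa>_def
  proof (rule Least_equality)
    show "Suc k \<le> y" if "\<not> ?B ^ y dvd f' - f" for y
      using that \<open>?B ^ k dvd f' - f\<close> power_le_dvd[of ?B k "f' - f" y] by (meson not_less_eq_eq)
  qed fact
  show ?thesis
  proof (rule that[of "h ` I"])
    show "finite (h ` I)" using F by (simp add: I_def)
    have "card (h ` I) \<le> card I" using F by (intro card_image_le) (simp add: I_def)
    also have "\<dots> = 3 * (2 * m + 1) * card F ^ 2"
      by (simp add: I_def card_cartesian_product power2_eq_square algebra_simps)
    finally show "card (h ` I) \<le> 3 * (2 * m + 1) * card F ^ 2" .
    fix N
    show "\<exists>N'\<in>h ` I. \<forall>f\<in>F. jump m (N + f) = jump m (N' + f)"
    proof (cases "\<exists>f\<in>F. N + f = 0")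
      case True
      then obtain f where f: "f \<in> F" "N = - f" by (auto simp: add_eq_0_iff2)
      \<comment> \<open>Here the valuations on \<open>N + F\<close> have no maximum, as 0 is
        divisible by every power; such \<open>N\<close> are listed directly.\<close>
      have "N = h (f, f, 0, 0)" using f by (simp add: h_def)
      moreover have "(f, f, 0, 0) \<in> I" using f by (simp add: I_def)
      ultimately show ?thesis by blast
    next
      case False
      let ?P = "\<lambda>k. \<forall>f\<in>F. \<not> ?B ^ k dvd N + f"
      obtain k0 where "\<forall>x\<in>(\<lambda>f. N + f) ` F. \<not> ?B ^ k0 dvd x"
        by (rule exists_power_not_dvd[of "(\<lambda>f. N + f) ` F" ?B]) (use F m False in auto)
      then have "?P k0" by blast
      then have Pk: "?P (LEAST k. ?P k)" by (rule LeastI)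
      moreover have "\<not> ?P 0" using F by auto
      ultimately have "(LEAST k. ?P k) \<noteq> 0" by metis
      then obtain l where l: "(LEAST k. ?P k) = Suc l" using not0_implies_Suc by blast
      have P: "\<not> ?B ^ Suc l dvd N + f" if "f \<in> F" for f using Pk that l by simp
      have "\<not> ?P l" using not_less_Least[of l ?P] l by simp
      then obtain g where g: "g \<in> F" "?B ^ l dvd N + g" by blast
      then obtain u where u: "N + g = ?B ^ l * u" by (auto simp: dvd_def)
      have uB: "\<not> ?B dvd u"
      proof
        assume "?B dvd u"
        then have "?B * ?B ^ l dvd u * ?B ^ l" by (rule mult_dvd_mono) simp
        then show False using P[OF g(1)] u unfolding power_Suc by (metis mult.commute)
      qed
      \<comment> \<open>Since \<open>u\<close> is not divisible by the radix, \<open>c\<close> is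
        the last nonzero digit of \<open>N + g\<close>.\<close>
      define c where "c = nat (u mod ?B)"
      have c: "int c = u mod ?B" "c < 2 * m + 1"
        using mod_radix_bounds[of u m] unfolding c_def by linarith+
      have cB: "\<not> ?B dvd int c" using uB c by (simp add: dvd_mod_iff)
      define N1 where "N1 = - g + int c * ?B ^ l"
      \<comment> \<open>\<open>N1\<close> agrees with \<open>N\<close> modulo
        \<open>?B ^ Suc l\<close>, and this power divides no element of \<open>N + F\<close>, so
        \<open>jump_cong\<close> applies.\<close>
      have N1: "jump m (N + f) = jump m (N1 + f)" if "f \<in> F" for f
      proof -
        have "?B dvd int c - u" unfolding c(1) by (simp add: mod_eq_dvd_iff[symmetric])
        then have "?B ^ Suc l dvd (int c - u) * ?B ^ l" by (simp add: mult_dvd_mono)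
        also have "(int c - u) * ?B ^ l = N1 + f - (N + f)"
          using u by (simp add: N1_def algebra_simps)
        finally have "?B ^ Suc l dvd N1 + f - (N + f)" .
        from jump_cong[OF m P[OF that] this] show ?thesis by (rule sym)
      qed
      show ?thesis
      proof (cases "\<exists>f'\<in>F. ?B ^ l dvd f' - g \<and> \<not> ?B ^ Suc l dvd f' - g")
        case True
        then obtain f' where f': "f' \<in> F" "?B ^ l dvd f' - g" "\<not> ?B ^ Suc l dvd f' - g" by blast
        have "N1 = h (g, f', c, 2)" using \<kappa>[OF f'(2,3)] by (simp add: h_def N1_def)
        moreover have "(g, f', c, 2) \<in> I" using g f' c by (simp add: I_def)
        ultimately show ?thesis using N1 by blast
      next
        case no_jump: False
        define A where "A j = {f \<in> F. ?B ^ j dvd f - g}" for j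
        \<comment> \<open>No \<open>f' - g\<close> has valuation exactly \<open>l\<close>, so the
          exponent can be lowered to the least \<open>j\<close> with the same set. On
          \<open>A l\<close> the last nonzero digit remains \<open>c\<close>; elsewhere the jump is
          that of \<open>f - g\<close> for both exponents.\<close>
        define j where "j = (LEAST j. A j = A l)"
        have j: "A j = A l" unfolding j_def by (rule LeastI) simp
        have jl: "j \<le> l" unfolding j_def by (rule Least_le) simp
        define N2 where "N2 = - g + int c * ?B ^ j"
        have "jump m (N1 + f) = jump m (N2 + f)" if f: "f \<in> F" for f
        proof (cases "f \<in> A l")
          case True
          then have "?B ^ Suc l dvd f - g" using no_jump f by (auto simp: A_def)
          then obtain v where v: "f - g = ?B ^ Suc l * v" by (auto simp: dvd_def)
          have *: "jump m (int c + ?B * w) = jump m (int c)" for w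
            using jump_cong[OF m, of 1 "int c" "int c + ?B * w"] cB by simp
          have "N1 + f = ?B ^ l * (int c + ?B * v)"
            using v by (simp add: N1_def algebra_simps)
          then have "jump m (N1 + f) = jump m (int c)" using jump_mult_power[OF m] * by metis
          moreover have "?B ^ Suc l = ?B ^ j * (?B * ?B ^ (l - j))"
            using jl by (simp flip: power_add power_Suc)
          then have "N2 + f = ?B ^ j * (int c + ?B * (?B ^ (l - j) * v))"
            using v unfolding N2_def by (simp only: distrib_left mult.assoc) (simp add: algebra_simps)
          then have "jump m (N2 + f) = jump m (int c)" using jump_mult_power[OF m] * by metis
          ultimately show ?thesis by simp
        next
          case False
          then have nd: "\<not> ?B ^ j dvd f - g" using f j by (auto simp: A_def)
          have "?B ^ j dvd int c * ?B ^ l" using jl by (simp add: le_imp_power_dvd)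
          then have "jump m (N1 + f) = jump m (f - g)"
            by (intro jump_cong[OF m nd]) (simp add: N1_def)
          moreover have "jump m (N2 + f) = jump m (f - g)"
            by (intro jump_cong[OF m nd]) (simp add: N2_def)
          ultimately show ?thesis by simp
        qed
        moreover have "N2 \<in> h ` I"
        proof (cases j)
          case 0
          then have "N2 = h (g, g, c, 0)" by (simp add: h_def N2_def)
          moreover have "(g, g, c, 0) \<in> I" using g c by (simp add: I_def)
          ultimately show ?thesis by blast
        next
          case (Suc i)
          \<comment> \<open>By minimality of \<open>j\<close>, some \<open>f'\<close> lies in
            \<open>A i\<close> but not in \<open>A j\<close>. Then \<open>f' - g\<close> has
            valuation \<open>i\<close>, and \<open>\<kappa> f' g\<close> is
            \<open>j\<close>.\<close>
          have "A i \<noteq> A j" using not_less_Least[of i "\<lambda>j. A j = A l"] j Suc by (simp add: j_def[symmetric])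
          moreover have "A j \<subseteq> A i" using Suc by (auto simp: A_def intro: dvd_mult_right)
          ultimately obtain f' where f': "f' \<in> F" "?B ^ i dvd f' - g" "\<not> ?B ^ Suc i dvd f' - g"
            using Suc by (auto simp: A_def)
          have "N2 = h (g, f', c, 1)" using \<kappa>[OF f'(2,3)] Suc by (simp add: h_def N2_def)
          moreover have "(g, f', c, 1) \<in> I" using g f' c by (simp add: I_def)
          ultimately show ?thesis by blast
        qed
        ultimately show ?thesis using N1 by (intro bexI[of _ N2]) auto
      qed
    qed
  qed
qed

lemma dseq_Suc_cong:
  assumes "dseq m a = dseq m b" "jump m (a + 1) = jump m (b + 1)"
  shows "dseq m (a + 1) = dseq m (b + 1)"
proof -
  have *: "int (dseq m (x + 1)) = (int (dseq m x) + jump m (x + 1)) mod int m" for x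
    by (simp add: dseq_def jump_def zmod_int mod_simps)
  show ?thesis using *[of a] *[of b] assms by simp
qed

text \<open>The factor \<open>m ^ n\<close> counts the values at the left ends of the
  \<open>n\<close> windows. The polynomial factor counts the increment patterns on the union
  \<open>F\<close> of the windows, which has at most \<open>n * (L + 1)\<close> points.\<close>

lemma dseq_window_patterns:
  fixes s :: "nat \<Rightarrow> int"
  assumes m: "m \<ge> 1" and n: "n \<ge> 1"
  obtains R where "finite R" "card R \<le> m ^ n * (3 * (2 * m + 1) * (n * (L + 1)) ^ 2)"
    "\<And>N. \<exists>N'\<in>R. \<forall>i\<in>{1..n}. \<forall>v\<le>L. dseq m (N + s i + int v) = dseq m (N' + s i + int v)"
proof -
  define F where "F = (\<lambda>(i, v). s i + int v) ` ({1..n} \<times> {..L})"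
  have F: "finite F" "F \<noteq> {}" using n by (auto simp: F_def)
  have cF: "card F \<le> n * (L + 1)"
    unfolding F_def using card_image_le[of "{1..n} \<times> {..L}" "\<lambda>(i, v). s i + int v"]
    by (simp add: card_cartesian_product)
  obtain R0 where R0: "finite R0" "card R0 \<le> 3 * (2 * m + 1) * card F ^ 2"
    "\<And>N. \<exists>N'\<in>R0. \<forall>f\<in>F. jump m (N + f) = jump m (N' + f)"
    using jump_patterns[OF m F] by metis
  define J where "J = (\<Pi>\<^sub>E i\<in>{1..n}. {..<m}) \<times> R0"
  define Q where "Q a r N \<longleftrightarrow> (\<forall>i\<in>{1..n}. dseq m (N + s i) = a i) \<and>
      (\<forall>f\<in>F. jump m (N + f) = jump m (r + f))" for a r N
  \<comment> \<open>A pair realised by no \<open>N\<close> is sent to an arbitrary integer; the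
    image still has at most as many elements as there are pairs.\<close>
  define h where "h = (\<lambda>(a, r). SOME N. Q a r N)"
  have J: "finite J" "card J = m ^ n * card R0"
    using R0 by (auto simp: J_def card_cartesian_product card_PiE intro: finite_PiE)
  show ?thesis
  proof (rule that[of "h ` J"])
    show "finite (h ` J)" using J by simp
    have "card (h ` J) \<le> m ^ n * card R0" using card_image_le[OF J(1), of h] J(2) by simp
    also have "\<dots> \<le> m ^ n * (3 * (2 * m + 1) * (n * (L + 1)) ^ 2)"
      using R0(2) cF by (meson le_refl mult_le_mono order_trans power_mono zero_le)
    finally show "card (h ` J) \<le> m ^ n * (3 * (2 * m + 1) * (n * (L + 1)) ^ 2)" .
    fix N
    obtain r where r: "r \<in> R0" "\<forall>f\<in>F. jump m (N + f) = jump m (r + f)" using R0(3) by blast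
    define a where "a = (\<lambda>i\<in>{1..n}. dseq m (N + s i))"
    have aJ: "(a, r) \<in> J" using r dseq_less[OF m] by (auto simp: J_def a_def)
    have QN: "Q a r N" using r by (simp add: Q_def a_def)
    then have QN': "Q a r (h (a, r))" unfolding h_def by (auto intro: someI)
    have "dseq m (N + s i + int v) = dseq m (h (a, r) + s i + int v)"
      if "i \<in> {1..n}" "v \<le> L" for i v
      using that(2)
    proof (induction v)
      case 0
      then show ?case using QN QN' that by (simp add: Q_def)
    next
      case (Suc v)
      have "s i + int (Suc v) \<in> F" using that(1) Suc.prems unfolding F_def
        by (intro image_eqI[of _ _ "(i, Suc v)"]) auto
      then have "jump m (N + (s i + int (Suc v))) = jump m (h (a, r) + (s i + int (Suc v)))"
        using QN QN' by (simp add: Q_def)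
      then show ?case
        using Suc dseq_Suc_cong[of m "N + s i + int v" "h (a, r) + s i + int v"]
        by (simp add: algebra_simps)
    qed
    then show "\<exists>N'\<in>h ` J. \<forall>i\<in>{1..n}. \<forall>v\<le>L. dseq m (N + s i + int v) = dseq m (N' + s i + int v)"
      using aJ by blast
  qed
qed

section \<open>The full shift and covers\<close>

lemma topspace_full_shift_top: "topspace (full_shift_top m) = {x. \<forall>h. x h < m}"
  by (auto simp: full_shift_top_def)

lemma compact_space_full_shift_top: "compact_space (full_shift_top m)"
  by (simp add: full_shift_top_def compact_space_product_topology compact_space_discrete_topology)

lemma openin_cylinder:
  assumes "finite F"
  shows "openin (full_shift_top m) {y \<in> topspace (full_shift_top m). \<forall>h\<in>F. y h = x h}"
proof -
  let ?U = "\<lambda>h. if h \<in> F then {..<m} \<inter> {x h} else {..<m}"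
  have "openin (full_shift_top m) (\<Pi>\<^sub>E h\<in>UNIV. ?U h)"
    unfolding full_shift_top_def
  proof (rule product_topology_basis)
    show "finite {h. ?U h \<noteq> topspace (discrete_topology {..<m})}"
      by (rule finite_subset[OF _ assms]) auto
  qed auto
  also have "(\<Pi>\<^sub>E h\<in>UNIV. ?U h) = {y \<in> topspace (full_shift_top m). \<forall>h\<in>F. y h = x h}"
    unfolding topspace_full_shift_top by (auto simp: PiE_iff split: if_splits)
  finally show ?thesis .
qed

lemma openin_full_shift_top_cylinder:
  assumes "openin (full_shift_top m) U" "x \<in> U"
  obtains F where "finite F"
    "\<And>y. y \<in> topspace (full_shift_top m) \<Longrightarrow> \<forall>h\<in>F. y h = x h \<Longrightarrow> y \<in> U"
proof -
  obtain V where V: "finite {h. V h \<noteq> {..<m}}" "x \<in> Pi\<^sub>E UNIV V" "Pi\<^sub>E UNIV V \<subseteq> U"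
    using assms unfolding full_shift_top_def openin_product_topology_alt by fastforce
  show ?thesis
  proof (rule that[OF V(1)])
    fix y assume y: "y \<in> topspace (full_shift_top m)" "\<forall>h\<in>{h. V h \<noteq> {..<m}}. y h = x h"
    have "y h \<in> V h" for h
      using y V(2) by (cases "V h = {..<m}") (auto simp: topspace_full_shift_top PiE_iff)
    then show "y \<in> U" using V(3) by (auto simp: PiE_iff)
  qed
qed

text \<open>\<open>shift (- g)\<close> inverts \<open>shift g\<close>, so the images occurring in
  the join of covers can be read as preimages.\<close>

lemma shift_image_eq: "shift (- g) ` A = {x. shift g x \<in> A}"
  for g :: "'g::group_add"
proof -
  have *: "shift (- g) (shift g x) = x" "shift g (shift (- g) x) = x" for x :: "'g \<Rightarrow> 'a"
    by (auto simp: shift_def add.assoc[symmetric])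
  show ?thesis using * by (auto intro: rev_image_eqI)
qed

lemma min_subcover_card_le:
  assumes "V \<subseteq> C" "finite V" "\<Union>V = topspace T"
  shows "min_subcover_card T C \<le> card V"
  unfolding min_subcover_card_def using assms by (intro cInf_lower) auto

lemma ln_div_le_growth:
  fixes k m n K :: nat
  assumes k: "k \<le> m ^ n * (K * n ^ 2)" and pos: "m \<ge> 1" "n \<ge> 1" "K \<ge> 1"
  shows "ln (real k) / real n \<le> ln (real m) + ln (real K) / real n + 2 * (ln (real n) / real n)"
proof -
  let ?M = "m ^ n * (K * n ^ 2)"
  have "?M \<ge> 1" using pos by (simp add: Suc_le_eq)
  then have "real ?M \<ge> 1" using of_nat_mono[of 1 ?M, where 'a=real] by simp
  \<comment> \<open>For \<open>k = 0\<close> the convention \<open>ln 0 = 0\<close> gives the bound,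
    since the right side is nonnegative.\<close>
  then have "ln (real k) \<le> ln (real ?M)"
    using of_nat_mono[OF k, where 'a=real]
    by (cases "k = 0") (auto intro: ln_mono simp del: of_nat_mult of_nat_power)
  also have "\<dots> = real n * ln (real m) + ln (real K) + 2 * ln (real n)"
    using pos by (simp add: ln_mult ln_realpow)
  finally have "ln (real k) / real n \<le> (real n * ln (real m) + ln (real K) + 2 * ln (real n)) / real n"
    using pos by (intro divide_right_mono) auto
  also have "\<dots> = ln (real m) + ln (real K) / real n + 2 * (ln (real n) / real n)"
    using pos by (simp add: field_simps)
  finally show ?thesis .
qed

text \<open>The subcover \<open>V0\<close> ensures that the infimum is taken over a nonempty
  set.\<close>

lemma le_min_subcover_card:
  assumes "V0 \<subseteq> C" "finite V0" "\<Union>V0 = topspace T"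
    and "\<And>V. V \<subseteq> C \<Longrightarrow> finite V \<Longrightarrow> \<Union>V = topspace T \<Longrightarrow> k \<le> card V"
  shows "k \<le> min_subcover_card T C"
  unfolding min_subcover_card_def using assms by (intro cInf_greatest) auto

section \<open>The digit subshift\<close>

locale digit_system =
  fixes f :: "'g::group_add \<Rightarrow> int" and m :: nat
  assumes f_add: "f (a + b) = f a + f b"
    and surj_f: "surj f"
    and m_pos: "m \<ge> 1"
begin

lemma f_zero: "f 0 = 0"
  using f_add[of 0 0] by simp

lemma f_minus: "f (- a) = - f a"
  using f_add[of "- a" a] f_zero by simp

text \<open>The closure of the pulled-back translates of \<open>dseq m\<close>, expressed by finite
  patterns: a point need not be a translate itself, but on any finitely many coordinates it looks
  like one.\<close>

definition digit_subshift :: "('g \<Rightarrow> nat) set" where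
  "digit_subshift = {x. \<forall>F. finite F \<longrightarrow> (\<exists>N. \<forall>h\<in>F. x h = dseq m (N + f h))}"

abbreviation subshift_top where
  "subshift_top \<equiv> subtopology (full_shift_top m) digit_subshift"

lemma dseq_in_digit_subshift: "(\<lambda>h. dseq m (N + f h)) \<in> digit_subshift"
  unfolding digit_subshift_def by blast

lemma digit_subshiftD:
  assumes "x \<in> digit_subshift" "finite F"
  obtains N where "\<forall>h\<in>F. x h = dseq m (N + f h)"
  using assms unfolding digit_subshift_def by blast

lemma digit_subshift_subset: "digit_subshift \<subseteq> topspace (full_shift_top m)"
  unfolding topspace_full_shift_top
proof safe
  fix x h assume "x \<in> digit_subshift"
  then obtain N where "\<forall>h'\<in>{h}. x h' = dseq m (N + f h')"
    by (rule digit_subshiftD[of _ "{h}"]) simp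
  then show "x h < m" using dseq_less[OF m_pos] by simp
qed

lemma topspace_subshift_top: "topspace subshift_top = digit_subshift"
  by (simp add: Int_absorb1 digit_subshift_subset)

lemma shift_digit_subshift:
  assumes "x \<in> digit_subshift"
  shows "shift g x \<in> digit_subshift"
  unfolding digit_subshift_def
proof (intro CollectI allI impI)
  fix F :: "'g set" assume "finite F"
  then obtain N where "\<forall>h\<in>(\<lambda>h. - g + h) ` F. x h = dseq m (N + f h)"
    by (rule digit_subshiftD[OF assms finite_imageI])
  then have "\<forall>h\<in>F. shift g x h = dseq m (N - f g + f h)"
    by (simp add: shift_def f_add f_minus algebra_simps)
  then show "\<exists>N. \<forall>h\<in>F. shift g x h = dseq m (N + f h)" by blast
qed

lemma closedin_digit_subshift: "closedin (full_shift_top m) digit_subshift"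
  unfolding closedin_def
proof (intro conjI digit_subshift_subset)
  let ?T = "topspace (full_shift_top m) :: ('g \<Rightarrow> nat) set"
  show "openin (full_shift_top m) (?T - digit_subshift)"
  proof (subst openin_subopen, intro ballI)
    fix x assume x: "x \<in> ?T - digit_subshift"
    then obtain F where F: "finite F" "\<And>N. \<exists>h\<in>F. x h \<noteq> dseq m (N + f h)"
      unfolding digit_subshift_def by blast
    let ?C = "{y \<in> ?T. \<forall>h\<in>F. y h = x h}"
    have "y \<notin> digit_subshift" if "y \<in> ?C" for y
    proof
      assume "y \<in> digit_subshift"
      from digit_subshiftD[OF this F(1)] obtain N where "\<forall>h\<in>F. y h = dseq m (N + f h)" .
      then show False using that F(2)[of N] by auto
    qed
    then show "\<exists>U. openin (full_shift_top m) U \<and> x \<in> U \<and> U \<subseteq> ?T - digit_subshift"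
      using x openin_cylinder[OF F(1)] by (intro exI[of _ ?C]) auto
  qed
qed

lemma is_subshift_digit_subshift: "is_subshift m digit_subshift"
  unfolding is_subshift_def
  using dseq_in_digit_subshift digit_subshift_subset closedin_digit_subshift shift_digit_subshift
  by blast

lemma compact_subshift_top: "compact_space subshift_top"
  using closedin_compact_space[OF compact_space_full_shift_top closedin_digit_subshift]
  by (rule compact_space_subtopology)

lemma openin_subshift_top_cylinder:
  assumes "openin subshift_top U" "x \<in> U"
  obtains F where "finite F" "\<And>y. y \<in> digit_subshift \<Longrightarrow> \<forall>h\<in>F. y h = x h \<Longrightarrow> y \<in> U"
proof -
  obtain W where W: "openin (full_shift_top m) W" "U = W \<inter> digit_subshift"
    using assms(1) by (auto simp: openin_subtopology)
  then have "x \<in> W" using assms(2) by blast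
  from openin_full_shift_top_cylinder[OF W(1) this] obtain F where F: "finite F"
    "\<And>y. y \<in> topspace (full_shift_top m) \<Longrightarrow> \<forall>h\<in>F. y h = x h \<Longrightarrow> y \<in> W"
    by blast
  show ?thesis
  proof (rule that[OF F(1)])
    fix y assume "y \<in> digit_subshift" "\<forall>h\<in>F. y h = x h"
    then show "y \<in> U" using F(2)[of y] W(2) digit_subshift_subset by auto
  qed
qed

lemma openin_subshift_top_cylinderI:
  assumes "finite F"
  shows "openin subshift_top {y \<in> digit_subshift. \<forall>h\<in>F. y h = x h}"
proof -
  let ?C = "{y \<in> topspace (full_shift_top m). \<forall>h\<in>F. y h = x h}"
  have "{y \<in> digit_subshift. \<forall>h\<in>F. y h = x h} = ?C \<inter> digit_subshift"
    using digit_subshift_subset by blast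
  then show ?thesis
    using openin_cylinder[OF assms, of m x] unfolding openin_subtopology by blast
qed

text \<open>The translate that \<open>x\<close> imitates is known only after a finite window is
  fixed. Because the return bound \<open>L\<close> is uniform in \<open>N\<close>, the window
  \<open>F2\<close> can be chosen first, containing the translates of \<open>F\<close> by lifts of
  all \<open>k < L\<close>; some \<open>k\<close> then shows the wanted pattern.\<close>

lemma shift_agree:
  assumes x: "x \<in> digit_subshift" and F: "finite F"
  obtains g where "\<forall>h\<in>F. shift g x h = dseq m (N' + f h)"
proof -
  obtain L where L: "\<And>N. \<exists>k<L. \<forall>e\<in>f ` F. dseq m (N + int k + e) = dseq m (N' + e)"
    using dseq_uniformly_recurrent[OF m_pos finite_imageI[OF F, of f], of N'] by metis
  define e where "e = inv f"
  have e: "f (e k) = k" for k by (simp add: e_def surj_f_inv_f[OF surj_f])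
  define F2 where "F2 = (\<lambda>(k, h). e (int k) + h) ` ({..<L} \<times> F)"
  have "finite F2" using F by (simp add: F2_def)
  then obtain N where N: "\<forall>h\<in>F2. x h = dseq m (N + f h)" by (rule digit_subshiftD[OF x])
  obtain k where k: "k < L" "\<forall>e\<in>f ` F. dseq m (N + int k + e) = dseq m (N' + e)" using L by blast
  have "shift (- e (int k)) x h = dseq m (N' + f h)" if "h \<in> F" for h
  proof -
    have "e (int k) + h \<in> F2" using k that by (force simp: F2_def)
    then have "x (e (int k) + h) = dseq m (N + int k + f h)"
      using N by (simp add: f_add e add.assoc)
    then show ?thesis using k that by (simp add: shift_def)
  qed
  then show ?thesis using that by blast
qed

lemma minimal_digit_subshift: "minimal_system subshift_top shift"
  unfolding minimal_system_def topspace_subshift_top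
proof (intro ballI subset_antisym subsetI)
  fix x y assume x: "x \<in> digit_subshift"
  {
    assume "y \<in> subshift_top closure_of range (\<lambda>g. shift g x)"
    then show "y \<in> digit_subshift" unfolding in_closure_of topspace_subshift_top by blast
  }
  assume y: "y \<in> digit_subshift"
  have "\<exists>z. z \<in> range (\<lambda>g. shift g x) \<and> z \<in> U" if U: "y \<in> U" "openin subshift_top U" for U
  proof -
    obtain F where F: "finite F" "\<And>z. z \<in> digit_subshift \<Longrightarrow> \<forall>h\<in>F. z h = y h \<Longrightarrow> z \<in> U"
      using openin_subshift_top_cylinder[OF U(2,1)] by metis
    obtain N' where N': "\<forall>h\<in>F. y h = dseq m (N' + f h)" using digit_subshiftD[OF y F(1)] .
    obtain g where "\<forall>h\<in>F. shift g x h = dseq m (N' + f h)" using shift_agree[OF x F(1)] .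
    then have "shift g x \<in> U" using N' shift_digit_subshift[OF x] by (intro F(2)) auto
    then show ?thesis by blast
  qed
  then show "y \<in> subshift_top closure_of range (\<lambda>g. shift g x)"
    using y unfolding in_closure_of topspace_subshift_top by blast
qed

section \<open>Upper bound for the sequence entropy\<close>

lemma cover_cylinders:
  assumes "open_cover subshift_top U"
  obtains F u where "finite F" "\<And>N. u N \<in> U"
    "\<And>N x. x \<in> digit_subshift \<Longrightarrow> \<forall>h\<in>F. x h = dseq m (N + f h) \<Longrightarrow> x \<in> u N"
proof -
  have U: "\<forall>A\<in>U. openin subshift_top A" "\<Union>U = digit_subshift"
    using assms unfolding open_cover_def topspace_subshift_top by (rule conjunct1, rule conjunct2)
  have "\<exists>A F. A \<in> U \<and> finite F \<and> (\<forall>y\<in>digit_subshift. (\<forall>h\<in>F. y h = x h) \<longrightarrow> y \<in> A)"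
    if x: "x \<in> digit_subshift" for x
  proof -
    obtain A where A: "A \<in> U" "x \<in> A" using x unfolding U(2)[symmetric] by blast
    obtain F where "finite F" "\<And>y. y \<in> digit_subshift \<Longrightarrow> \<forall>h\<in>F. y h = x h \<Longrightarrow> y \<in> A"
      using openin_subshift_top_cylinder[OF bspec[OF U(1) A(1)] A(2)] by blast
    then show ?thesis using A(1) by (intro exI[of _ A] exI[of _ F]) simp
  qed
  then obtain A \<Phi> where A: "\<And>x. x \<in> digit_subshift \<Longrightarrow> A x \<in> U \<and> finite (\<Phi> x) \<and>
      (\<forall>y\<in>digit_subshift. (\<forall>h\<in>\<Phi> x. y h = x h) \<longrightarrow> y \<in> A x)"
    by metis
  \<comment> \<open>A Lebesgue number argument: finitely many of these cylinders cover the subshift,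
    and the union \<open>F\<close> of their windows decides membership in a cover element for every
    point at once.\<close>
  define C where "C x = {y \<in> digit_subshift. \<forall>h\<in>\<Phi> x. y h = x h}" for x
  have op: "\<forall>V\<in>C ` digit_subshift. openin subshift_top V"
    unfolding C_def using openin_subshift_top_cylinderI A by blast
  have "\<Union>(C ` digit_subshift) = topspace subshift_top"
    unfolding topspace_subshift_top by (auto simp: C_def)
  with op compact_subshift_top obtain \<F> where \<F>: "finite \<F>" "\<F> \<subseteq> C ` digit_subshift"
    "\<Union>\<F> = topspace subshift_top"
    unfolding compact_space by metis
  then obtain P where P: "finite P" "P \<subseteq> digit_subshift" "\<F> = C ` P"
    by (meson finite_subset_image)
  define F where "F = \<Union>(\<Phi> ` P)"
  have F: "finite F" using P A by (auto simp: F_def)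
  have "\<exists>B\<in>U. \<forall>x\<in>digit_subshift. (\<forall>h\<in>F. x h = dseq m (N + f h)) \<longrightarrow> x \<in> B" for N
  proof -
    let ?y = "\<lambda>h. dseq m (N + f h)"
    have "?y \<in> \<Union>(C ` P)" using \<F>(3) P(3) topspace_subshift_top dseq_in_digit_subshift by simp
    then obtain p where p: "p \<in> P" "?y \<in> C p" by blast
    show ?thesis
    proof (intro bexI[of _ "A p"] ballI impI)
      show "A p \<in> U" using A p P by blast
      fix x assume x: "x \<in> digit_subshift" "\<forall>h\<in>F. x h = dseq m (N + f h)"
      have "\<forall>h\<in>\<Phi> p. x h = p h" using x p by (auto simp: F_def C_def)
      then show "x \<in> A p" using A[of p] p P x by blast
    qed
  qed
  then obtain u where "\<And>N. u N \<in> U" "\<And>N. \<forall>x\<in>digit_subshift. (\<forall>h\<in>F. x h = dseq m (N + f h)) \<longrightarrow> x \<in> u N"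
    by metis
  then show ?thesis using that[of F u] F by blast
qed

abbreviation shift_join where
  "shift_join U S n \<equiv> cover_join subshift_top (\<lambda>i. (\<lambda>A. shift (- S i) ` A) ` U) n"

text \<open>The image of the window \<open>F\<close> under \<open>f\<close> lies in
  \<open>[-w, w]\<close>, so \<open>S\<close> moves it into \<open>n\<close> integer windows of
  length \<open>2 * w + 1\<close>. Each pattern on these windows selects one member of the join. The
  constant \<open>K\<close> depends on the cover alone, which makes the bound uniform in
  \<open>S\<close> and \<open>n\<close>.\<close>

lemma subcover_bound:
  assumes "open_cover subshift_top U"
  obtains K where "K \<ge> 1" "\<And>n S. n \<ge> 1 \<Longrightarrow> \<exists>V. V \<subseteq> shift_join U S n \<and> finite V \<and>
      \<Union>V = topspace subshift_top \<and> card V \<le> m ^ n * (K * n ^ 2)"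
proof -
  obtain F u where F: "finite F" and u: "\<And>N. u N \<in> U"
    "\<And>N x. x \<in> digit_subshift \<Longrightarrow> \<forall>h\<in>F. x h = dseq m (N + f h) \<Longrightarrow> x \<in> u N"
    using cover_cylinders[OF assms] by metis
  obtain w :: nat where w: "\<forall>h\<in>F. nat \<bar>f h\<bar> \<le> w"
    using F finite_nat_set_iff_bounded_le[of "(\<lambda>h. nat \<bar>f h\<bar>) ` F"] by auto
  show ?thesis
  proof (rule that[of "3 * (2 * m + 1) * (2 * w + 1) ^ 2"])
    show "3 * (2 * m + 1) * (2 * w + 1) ^ 2 \<ge> 1" by (simp only: Suc_le_eq One_nat_def) simp
    fix n :: nat and S :: "nat \<Rightarrow> 'g" assume n: "n \<ge> 1"
    obtain R where R: "finite R" "card R \<le> m ^ n * (3 * (2 * m + 1) * (n * (2 * w + 1)) ^ 2)"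
      "\<And>N. \<exists>N'\<in>R. \<forall>i\<in>{1..n}. \<forall>v\<le>2 * w.
        dseq m (N + (- f (S i) - int w) + int v) = dseq m (N' + (- f (S i) - int w) + int v)"
      using dseq_window_patterns[OF m_pos n, of "2 * w" "\<lambda>i. - f (S i) - int w"] by metis
    \<comment> \<open>If \<open>x\<close> looks like the translate by \<open>N'\<close>, then
      \<open>shift (S i) x\<close> looks like the translate by \<open>N' - f (S i)\<close>, which
      dictates the cover element for index \<open>i\<close>.\<close>
    define E where "E N' = topspace subshift_top \<inter> (\<Inter>i\<in>{1..n}. shift (- S i) ` u (N' - f (S i)))" for N'
    have "E ` R \<subseteq> shift_join U S n"
      unfolding cover_join_def E_def using u(1) by blast
    moreover have "x \<in> \<Union>(E ` R)" if x: "x \<in> digit_subshift" for x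
    proof -
      have "finite ((\<lambda>(i, h). - S i + h) ` ({1..n} \<times> F))" using F by simp
      then obtain N where N: "\<forall>h\<in>(\<lambda>(i, h). - S i + h) ` ({1..n} \<times> F). x h = dseq m (N + f h)"
        by (rule digit_subshiftD[OF x])
      obtain N' where N': "N' \<in> R" "\<forall>i\<in>{1..n}. \<forall>v\<le>2 * w.
          dseq m (N + (- f (S i) - int w) + int v) = dseq m (N' + (- f (S i) - int w) + int v)"
        using R(3) by blast
      have "shift (S i) x \<in> u (N' - f (S i))" if i: "i \<in> {1..n}" for i
      proof (rule u(2)[OF shift_digit_subshift[OF x]], intro ballI)
        fix h assume h: "h \<in> F"
        then have "\<bar>f h\<bar> \<le> int w" using w by fastforce
        then obtain v where v: "v \<le> 2 * w" "f h = int v - int w"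
          using that[of "nat (f h + int w)"] by fastforce
        have "shift (S i) x h = dseq m (N + (- f (S i) - int w) + int v)"
        proof -
          have "shift (S i) x h = dseq m (N + f (- S i + h))"
          proof -
            have "- S i + h \<in> (\<lambda>(i, h). - S i + h) ` ({1..n} \<times> F)" using i h by force
            then show ?thesis using N unfolding shift_def by blast
          qed
          then show ?thesis by (simp add: f_add f_minus v(2) algebra_simps)
        qed
        also have "\<dots> = dseq m (N' + (- f (S i) - int w) + int v)" using N' v i by blast
        finally show "shift (S i) x h = dseq m (N' - f (S i) + f h)"
          unfolding v(2) by (simp add: algebra_simps)
      qed
      then have "x \<in> E N'" using x unfolding E_def topspace_subshift_top by (auto simp: shift_image_eq)
      then show ?thesis using N' by blast
    qed
    then have "\<Union>(E ` R) = topspace subshift_top"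
      unfolding E_def topspace_subshift_top by blast
    moreover have "card (E ` R) \<le> m ^ n * (3 * (2 * m + 1) * (2 * w + 1) ^ 2 * n ^ 2)"
      using order_trans[OF card_image_le[OF R(1), of E] R(2)]
      by (simp only: power_mult_distrib mult.assoc mult.commute[of "n ^ 2"])
    ultimately show "\<exists>V. V \<subseteq> shift_join U S n \<and> finite V \<and> \<Union>V = topspace subshift_top \<and>
        card V \<le> m ^ n * (3 * (2 * m + 1) * (2 * w + 1) ^ 2 * n ^ 2)"
      using R(1) by blast
  qed
qed

lemma seq_entropy_cover_le:
  assumes "open_cover subshift_top U"
  shows "seq_entropy_cover subshift_top shift U S \<le> ereal (ln (real m))"
proof -
  obtain K where K: "K \<ge> 1" "\<And>n S. n \<ge> 1 \<Longrightarrow> \<exists>V. V \<subseteq> shift_join U S n \<and> finite V \<and>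
      \<Union>V = topspace subshift_top \<and> card V \<le> m ^ n * (K * n ^ 2)"
    using subcover_bound[OF assms] by metis
  let ?N = "\<lambda>n. min_subcover_card subshift_top (shift_join U S n)"
  let ?b = "\<lambda>n. ln (real m) + ln (real K) / real n + 2 * (ln (real n) / real n)"
  have "ereal (ln (real (?N n)) / real n) \<le> ereal (?b n)" if n: "n \<ge> 1" for n
  proof -
    obtain V where V: "V \<subseteq> shift_join U S n" "finite V" "\<Union>V = topspace subshift_top"
      "card V \<le> m ^ n * (K * n ^ 2)"
      using K(2)[OF n, of S] by (elim exE conjE)
    have "?N n \<le> m ^ n * (K * n ^ 2)"
      using min_subcover_card_le[OF V(1-3)] V(4) by (rule order_trans)
    then show ?thesis using ln_div_le_growth[OF _ m_pos n K(1)] by simp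
  qed
  then have "\<forall>\<^sub>F n in sequentially. ereal (ln (real (?N n)) / real n) \<le> ereal (?b n)"
    unfolding eventually_sequentially by blast
  then have "seq_entropy_cover subshift_top shift U S \<le> limsup (\<lambda>n. ereal (?b n))"
    unfolding seq_entropy_cover_def by (rule Limsup_mono)
  also have "?b \<longlonglongrightarrow> ln (real m) + 0 + 2 * 0"
    by (intro tendsto_intros lim_ln_over_n real_tendsto_divide_at_top[OF tendsto_const] filterlim_real_sequentially)
  then have "limsup (\<lambda>n. ereal (?b n)) = ereal (ln (real m))"
    by (intro lim_imp_Limsup) auto
  finally show ?thesis .
qed

section \<open>Lower bound for the sequence entropy\<close>

definition coord_cover :: "('g \<Rightarrow> nat) set set" where
  "coord_cover = (\<lambda>a. {x \<in> digit_subshift. x 0 = a}) ` {..<m}"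

lemma open_cover_coord_cover: "open_cover subshift_top coord_cover"
proof -
  have "openin subshift_top {x \<in> digit_subshift. x 0 = a}" for a
    using openin_subshift_top_cylinderI[of "{0}" "\<lambda>_. a"] by simp
  moreover have "\<Union>coord_cover = digit_subshift"
    using digit_subshift_subset by (auto simp: coord_cover_def topspace_full_shift_top)
  ultimately show ?thesis
    unfolding open_cover_def topspace_subshift_top by (auto simp: coord_cover_def)
qed

text \<open>\<open>S i\<close> lifts \<open>- (radix m ^ i)\<close>; the sign compensates for
  \<open>shift (S i) x 0 = x (- S i)\<close>. The points are pullbacks of translates given by
  \<open>dseq_independent\<close>.\<close>

lemma independent_sequence:
  obtains S :: "nat \<Rightarrow> 'g" where "\<And>n a. (\<And>i. i \<in> {1..n} \<Longrightarrow> a i < m) \<Longrightarrow>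
    \<exists>x\<in>digit_subshift. \<forall>i\<in>{1..n}. x (- S i) = a i"
proof -
  define e where "e = inv f"
  have e: "f (e k) = k" for k by (simp add: e_def surj_f_inv_f[OF surj_f])
  show ?thesis
  proof (rule that[of "\<lambda>i. - e (radix m ^ i)"])
    fix n and a :: "nat \<Rightarrow> nat" assume a: "\<And>i. i \<in> {1..n} \<Longrightarrow> a i < m"
    \<comment> \<open>The length \<open>Suc n\<close> reaches index \<open>n\<close>, because
      \<open>dseq_independent\<close> counts from 0.\<close>
    obtain N where N: "\<forall>i<Suc n. dseq m (N + radix m ^ i) = a i mod m"
      using dseq_independent[OF m_pos, of 0 "Suc n" a] by blast
    have "dseq m (N + f (- (- e (radix m ^ i)))) = a i" if "i \<in> {1..n}" for i
      using N a[OF that] that by (simp add: e)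
    then show "\<exists>x\<in>digit_subshift. \<forall>i\<in>{1..n}. x (- (- e (radix m ^ i))) = a i"
      by (intro bexI[OF _ dseq_in_digit_subshift[of N]]) simp
  qed
qed

text \<open>All points of one member of the join share their values at the coordinates
  \<open>- S i\<close>. Points realising different words thus lie in different members, which gives
  an injection from the \<open>m ^ n\<close> words into \<open>V\<close>.\<close>

lemma card_subcover_ge:
  fixes S :: "nat \<Rightarrow> 'g"
  assumes S: "\<And>a. (\<And>i. i \<in> {1..n} \<Longrightarrow> a i < m) \<Longrightarrow>
      \<exists>x\<in>digit_subshift. \<forall>i\<in>{1..n}. x (- S i) = a i"
    and V: "V \<subseteq> shift_join coord_cover S n" "finite V" "\<Union>V = topspace subshift_top"
  shows "m ^ n \<le> card V"
proof -
  let ?P = "\<Pi>\<^sub>E i\<in>{1..n}. {..<m}"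
  have "\<exists>x\<in>digit_subshift. \<forall>i\<in>{1..n}. x (- S i) = a i" if "a \<in> ?P" for a
    using that by (intro S) (auto simp: PiE_iff)
  then obtain p where p: "\<And>a. a \<in> ?P \<Longrightarrow> p a \<in> digit_subshift \<and> (\<forall>i\<in>{1..n}. p a (- S i) = a i)"
    by metis
  have "\<exists>v\<in>V. p a \<in> v" if "a \<in> ?P" for a
    using p[OF that] V(3) topspace_subshift_top by blast
  then obtain v where v: "\<And>a. a \<in> ?P \<Longrightarrow> v a \<in> V \<and> p a \<in> v a" by metis
  have "inj_on v ?P"
  proof (rule inj_onI)
    fix a b assume ab: "a \<in> ?P" "b \<in> ?P" "v a = v b"
    have "v a \<in> shift_join coord_cover S n" using v[OF ab(1)] V(1) by auto
    then obtain B where B: "v a = topspace subshift_top \<inter> (\<Inter>i\<in>{1..n}. B i)"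
      "\<forall>i\<in>{1..n}. B i \<in> (\<lambda>A. shift (- S i) ` A) ` coord_cover"
      unfolding cover_join_def mem_Collect_eq by (elim exE conjE)
    have "a i = b i" if i: "i \<in> {1..n}" for i
    proof -
      have "B i \<in> (\<lambda>A. shift (- S i) ` A) ` coord_cover" using B(2) i by (rule bspec)
      then obtain c where c: "B i = shift (- S i) ` {x \<in> digit_subshift. x 0 = c}"
        unfolding coord_cover_def by blast
      have "p a \<in> v a" using v[OF ab(1)] by (rule conjunct2)
      then have "p a \<in> B i" unfolding B(1) using i by (rule INT_D[OF IntD2])
      moreover have "p b \<in> v a" using v[OF ab(2)] unfolding ab(3) by (rule conjunct2)
      then have "p b \<in> B i" unfolding B(1) using i by (rule INT_D[OF IntD2])
      ultimately have "p a (- S i) = p b (- S i)" unfolding c shift_image_eq by (simp add: shift_def)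
      then show ?thesis using p[OF ab(1)] p[OF ab(2)] i by simp
    qed
    then show "a = b" using ab by (intro PiE_ext) auto
  qed
  then have "card ?P \<le> card V" using v V(2) by (intro card_inj_on_le[of v]) auto
  then show ?thesis by (simp add: card_PiE)
qed

lemma seq_entropy_coord_cover_ge:
  obtains S :: "nat \<Rightarrow> 'g" where "ereal (ln (real m)) \<le> seq_entropy_cover subshift_top shift coord_cover S"
proof -
  obtain S :: "nat \<Rightarrow> 'g" where S: "\<And>n a. (\<And>i. i \<in> {1..n} \<Longrightarrow> a i < m) \<Longrightarrow>
    \<exists>x\<in>digit_subshift. \<forall>i\<in>{1..n}. x (- S i) = a i"
    using independent_sequence by metis
  let ?N = "\<lambda>n. min_subcover_card subshift_top (shift_join coord_cover S n)"
  have "ereal (ln (real m)) \<le> ereal (ln (real (?N n)) / real n)" if n: "n \<ge> 1" for n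
  proof -
    \<comment> \<open>Only the existence of a finite subcover matters here, to have a nonempty set
      under the infimum.\<close>
    obtain V where V: "V \<subseteq> shift_join coord_cover S n" "finite V" "\<Union>V = topspace subshift_top"
      using subcover_bound[OF open_cover_coord_cover] n by metis
    have "m ^ n \<le> ?N n"
      by (rule le_min_subcover_card[OF V]) (rule card_subcover_ge[OF S])
    then have "real m ^ n \<le> real (?N n)" by (metis of_nat_le_iff of_nat_power)
    then have "ln (real m ^ n) \<le> ln (real (?N n))" using m_pos by (intro ln_mono) auto
    then have "real n * ln (real m) \<le> ln (real (?N n))" using m_pos by (simp add: ln_realpow)
    then show ?thesis using n by (simp add: field_simps)
  qed
  then have "limsup (\<lambda>n. ereal (ln (real m))) \<le> seq_entropy_cover subshift_top shift coord_cover S"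
    unfolding seq_entropy_cover_def
    by (intro Limsup_mono) (auto simp: eventually_sequentially intro: exI[of _ 1])
  then show ?thesis using that by (simp add: Limsup_const)
qed

lemma top_seq_entropy_digit_subshift:
  "top_seq_entropy subshift_top shift = ereal (ln (real m))"
proof (rule antisym)
  show "top_seq_entropy subshift_top shift \<le> ereal (ln (real m))"
    unfolding top_seq_entropy_def by (auto intro!: SUP_least seq_entropy_cover_le)
  obtain S where S: "ereal (ln (real m)) \<le> seq_entropy_cover subshift_top shift coord_cover S"
    using seq_entropy_coord_cover_ge .
  also have "\<dots> \<le> top_seq_entropy subshift_top shift"
    unfolding top_seq_entropy_def
    by (rule SUP_upper2[of "(coord_cover, S)"]) (simp_all add: open_cover_coord_cover)
  finally show "ereal (ln (real m)) \<le> top_seq_entropy subshift_top shift" .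
qed

end

theorem theorem1p1:
  fixes m :: nat
  assumes "countable (UNIV :: 'g::group_add set)"
    and "infinite (UNIV :: 'g set)"
    and "\<exists>f :: 'g \<Rightarrow> int. (\<forall>a b. f (a + b) = f a + f b) \<and> surj f"
    and "m \<ge> 1"
  shows "\<exists>X :: ('g \<Rightarrow> nat) set. is_subshift m X
           \<and> minimal_system (subtopology (full_shift_top m) X) (shift :: 'g \<Rightarrow> _)
           \<and> top_seq_entropy (subtopology (full_shift_top m) X) (shift :: 'g \<Rightarrow> _) = ereal (ln (real m))"
proof -
  from assms(3) obtain f :: "'g \<Rightarrow> int" where f: "\<forall>a b. f (a + b) = f a + f b" "surj f" by blast
  interpret digit_system f m using f assms(4) by unfold_locales auto
  show ?thesis
    by (intro exI[of _ digit_subshift] conjI is_subshift_digit_subshift minimal_digit_subshift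
        top_seq_entropy_digit_subshift)
qed

end
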